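(* Let $z_n\to z$ in $Y$. Assume that $S\colon U\to Y$ is weak-to-weak continuous (i.e., $u_i\rightharpoonup u$ in $U$ implies $S(u_i)\rightharpoonup S(u)$ in $Y$) and compact. Then any sequence $\{u_n\}_{n\in\mathbb N}$ of minimizers $u_n$ of $\mathcal E^{z_n}$ over $U$ contains a subsequence converging weakly in $U$ to a minimizer $\bar u$ of $\mathcal E^z$ over $U$. The corresponding states $y_n=S(u_n)$ converge, along this subsequence, strongly in $Y$ to $\bar y=S(\bar u)$.
   Context: $\Omega\subset\mathbb R^n$ is a bounded open domain, $m\ge 2$, $U=L^2(\Omega;\mathbb R^m)$, $Y$ is a (real) Hilbert space, and $S\colon U\to Y$ is a (possibly nonlinear) operator. $\mathcal M\subset\mathbb R^m$ is a finite set and $g\colon\mathbb R^m\to\mathbb R\cup\{\infty\}$ is proper, convex, and lower semi-continuous with $\operatorname{dom} g=\operatorname{co}\mathcal M$ (the convex hull of $\mathcal M$). For $z\in Y$, $\mathcal E^z(u)=\frac12\|S(u)-z\|_Y^2+\int_\Omega g(u(x))\,\mathrm dx$ for $u\in U$. Compactness of $S$ means that $S$ maps bounded sets to relatively compact sets; weak-to-weak continuity is understood for sequences. *)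

theory Defs
  imports "HOL-Analysis.Analysis"
begin

text \<open>
  An element of $L^2$ is represented by a square integrable function; equality in $L^2$ is equality
  almost everywhere. Operators on $L^2$ are functions on representatives that respect this equality.
\<close>

definition L2_space :: "'a measure \<Rightarrow> ('a \<Rightarrow> 'b::euclidean_space) set" where
  "L2_space M = {u \<in> borel_measurable M. integrable M (\<lambda>x. (norm (u x))\<^sup>2)}"

definition L2_inner :: "'a measure \<Rightarrow> ('a \<Rightarrow> 'b::euclidean_space) \<Rightarrow> ('a \<Rightarrow> 'b) \<Rightarrow> real" where
  "L2_inner M u v = (\<integral>x. u x \<bullet> v x \<partial>M)"

definition L2_norm :: "'a measure \<Rightarrow> ('a \<Rightarrow> 'b::euclidean_space) \<Rightarrow> real" where
  "L2_norm M u = sqrt (\<integral>x. (norm (u x))\<^sup>2 \<partial>M)"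

definition L2_operator :: "'a measure \<Rightarrow> (('a \<Rightarrow> 'b::euclidean_space) \<Rightarrow> 'y) \<Rightarrow> bool" where
  "L2_operator M S \<longleftrightarrow>
    (\<forall>u\<in>L2_space M. \<forall>v\<in>L2_space M. (AE x in M. u x = v x) \<longrightarrow> S u = S v)"

definition L2_weakly_tendsto ::
    "'a measure \<Rightarrow> (nat \<Rightarrow> 'a \<Rightarrow> 'b::euclidean_space) \<Rightarrow> ('a \<Rightarrow> 'b) \<Rightarrow> bool" where
  "L2_weakly_tendsto M u l \<longleftrightarrow>
    (\<forall>i. u i \<in> L2_space M) \<and> l \<in> L2_space M \<and>
    (\<forall>v\<in>L2_space M. (\<lambda>i. L2_inner M (u i) v) \<longlonglongrightarrow> L2_inner M l v)"

definition weakly_tendsto :: "(nat \<Rightarrow> 'y::real_inner) \<Rightarrow> 'y \<Rightarrow> bool" where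
  "weakly_tendsto y l \<longleftrightarrow> (\<forall>w. (\<lambda>i. y i \<bullet> w) \<longlonglongrightarrow> l \<bullet> w)"

definition weak_to_weak_continuous ::
    "'a measure \<Rightarrow> (('a \<Rightarrow> 'b::euclidean_space) \<Rightarrow> 'y::real_inner) \<Rightarrow> bool" where
  "weak_to_weak_continuous M S \<longleftrightarrow>
    (\<forall>u l. L2_weakly_tendsto M u l \<longrightarrow> weakly_tendsto (\<lambda>i. S (u i)) (S l))"

definition L2_bounded :: "'a measure \<Rightarrow> ('a \<Rightarrow> 'b::euclidean_space) set \<Rightarrow> bool" where
  "L2_bounded M B \<longleftrightarrow> B \<subseteq> L2_space M \<and> (\<exists>C. \<forall>u\<in>B. L2_norm M u \<le> C)"

definition compact_operator ::
    "'a measure \<Rightarrow> (('a \<Rightarrow> 'b::euclidean_space) \<Rightarrow> 'y::real_inner) \<Rightarrow> bool" where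
  "compact_operator M S \<longleftrightarrow> (\<forall>B. L2_bounded M B \<longrightarrow> compact (closure (S ` B)))"

definition edom :: "('v \<Rightarrow> ereal) \<Rightarrow> 'v set" where
  "edom g = {v. g v < \<infinity>}"

definition proper_fun :: "('v \<Rightarrow> ereal) \<Rightarrow> bool" where
  "proper_fun g \<longleftrightarrow> (\<forall>v. g v \<noteq> -\<infinity>) \<and> edom g \<noteq> {}"

definition convex_fun :: "('v::real_vector \<Rightarrow> ereal) \<Rightarrow> bool" where
  "convex_fun g \<longleftrightarrow>
    (\<forall>v w. \<forall>t\<in>{0..1::real}.
      g ((1 - t) *\<^sub>R v + t *\<^sub>R w) \<le> ereal (1 - t) * g v + ereal t * g w)"

definition lsc_fun :: "('v::topological_space \<Rightarrow> ereal) \<Rightarrow> bool" where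
  "lsc_fun g \<longleftrightarrow> (\<forall>v. g v \<le> Liminf (at v) g)"

text \<open>
  The Lebesgue integral of an extended real function as the integral of its positive part minus the
  integral of its negative part; \<^const>\<open>e2ennreal\<close> sends negative values to \<open>0\<close>. This is
  \<open>\<infinity>\<close> or a real number whenever the negative part has finite integral.
\<close>

definition ereal_integral :: "'a measure \<Rightarrow> ('a \<Rightarrow> ereal) \<Rightarrow> ereal" where
  "ereal_integral M f =
    enn2ereal (\<integral>\<^sup>+x. e2ennreal (f x) \<partial>M) - enn2ereal (\<integral>\<^sup>+x. e2ennreal (- f x) \<partial>M)"

definition energy ::
    "'a measure \<Rightarrow> (('a \<Rightarrow> 'b::euclidean_space) \<Rightarrow> 'y::real_inner) \<Rightarrow> ('b \<Rightarrow> ereal) \<Rightarrow>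
      'y \<Rightarrow> ('a \<Rightarrow> 'b) \<Rightarrow> ereal" where
  "energy M S g z u =
    ereal (1 / 2 * (norm (S u - z))\<^sup>2) + ereal_integral M (\<lambda>x. g (u x))"

definition is_minimizer ::
    "'a measure \<Rightarrow> (('a \<Rightarrow> 'b::euclidean_space) \<Rightarrow> 'y::real_inner) \<Rightarrow> ('b \<Rightarrow> ereal) \<Rightarrow>
      'y \<Rightarrow> ('a \<Rightarrow> 'b) \<Rightarrow> bool" where
  "is_minimizer M S g z u \<longleftrightarrow> is_arg_min (energy M S g z) (\<lambda>v. v \<in> L2_space M) u"

end

theory Submission
  imports Defs "HOL-Complex_Analysis.Great_Picard"
begin

text \<open>
  A minimizer has finite energy, so its values lie almost everywhere in the domain of \<open>g\<close>, which
  is the convex hull of a finite set and therefore compact. The minimizers are thus bounded by one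
  constant almost everywhere, and on a domain of finite measure such a sequence has a subsequence
  \<open>u\<^sub>k\<close> that converges weakly in \<open>L\<^sup>2\<close> to some \<open>l\<close>. By compactness of \<open>S\<close> a further subsequence
  of the states converges strongly, and by weak-to-weak continuity its limit can only be \<open>S l\<close>. If
  \<open>\<Phi> v\<close> is the integral of \<open>g \<circ> v\<close>, minimality gives
  \<open>\<Phi> u\<^sub>k \<le> (norm (S v - z\<^sub>k))\<^sup>2 / 2 - (norm (S u\<^sub>k - z\<^sub>k))\<^sup>2 / 2 + \<Phi> v\<close> for every competitor \<open>v\<close>. The
  right-hand side converges, and \<open>\<Phi>\<close> is weakly lower semicontinuous because \<open>g\<close> is convex and lower
  semicontinuous; hence \<open>l\<close> minimizes the limit energy.

  Both facts about weak convergence, compactness and lower semicontinuity, come from one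
  construction. From the convex hull of each tail of a bounded sequence take an element of almost
  minimal \<open>L\<^sup>2\<close> norm. The parallelogram law makes a suitable choice of these elements a fast Cauchy
  sequence, which converges almost everywhere (\<open>tail_hulls_AE_convergent\<close>). Since only midpoints
  enter the parallelogram law, the closure under midpoints can replace the convex hull.

  For compactness (\<open>ess_bounded_weakly_convergent_subseq\<close>), pass to a subsequence along which the
  inner products with every member of the sequence converge. The almost everywhere limits built from
  its subsequences then have the same inner products with all members of the sequence, and they lie
  in its closed span, so they coincide; this common limit is the weak limit. For
  lower semicontinuity (\<open>nn_integral_sublevel_weakly_closed\<close>), the construction applied to a weakly
  convergent sequence must return the weak limit, so the limit is an almost everywhere limit of
  elements of the hull, on which convexity controls \<open>\<Phi>\<close>; Fatou's lemma concludes.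
\<close>

section \<open>Midpoint hulls and the inner product of square integrable functions\<close>

text \<open>
  The convex hull of a set of functions, reduced to what the parallelogram law and midpoint
  convexity consume. A property that is stable under midpoints passes to the hull by rule induction.
\<close>

inductive_set midpoint_hull :: "('a \<Rightarrow> 'b::real_vector) set \<Rightarrow> ('a \<Rightarrow> 'b) set"
  for U :: "('a \<Rightarrow> 'b) set" where
  base: "f \<in> U \<Longrightarrow> f \<in> midpoint_hull U"
| midpoint: "f \<in> midpoint_hull U \<Longrightarrow> h \<in> midpoint_hull U \<Longrightarrow>
    (\<lambda>x. (1/2) *\<^sub>R (f x + h x)) \<in> midpoint_hull U"

lemma midpoint_hull_mono:
  assumes "U \<subseteq> V" shows "midpoint_hull U \<subseteq> midpoint_hull V"
proof
  fix f assume "f \<in> midpoint_hull U"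
  then show "f \<in> midpoint_hull V"
    using assms by induction (auto intro: midpoint_hull.intros)
qed

definition ess_bounded :: "'a measure \<Rightarrow> real \<Rightarrow> ('a \<Rightarrow> 'b::euclidean_space) \<Rightarrow> bool" where
  "ess_bounded M B f \<longleftrightarrow> f \<in> borel_measurable M \<and> (AE x in M. norm (f x) \<le> B)"

lemma ess_bounded_midpoint_hull:
  assumes "f \<in> midpoint_hull U" and "\<And>h. h \<in> U \<Longrightarrow> ess_bounded M B h"
  shows "ess_bounded M B f"
  using assms(1)
proof induction
  case (midpoint f h)
  then have [measurable]: "f \<in> borel_measurable M" "h \<in> borel_measurable M"
    and "AE x in M. norm (f x) \<le> B" "AE x in M. norm (h x) \<le> B"
    by (auto simp: ess_bounded_def)
  from this(3,4) have "AE x in M. norm ((1/2) *\<^sub>R (f x + h x)) \<le> B"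
  proof eventually_elim
    case (elim x)
    then show ?case using norm_triangle_ineq[of "f x" "h x"] by simp
  qed
  then show ?case by (simp add: ess_bounded_def)
qed (use assms in auto)

lemma (in finite_measure) ess_bounded_imp_L2:
  assumes "ess_bounded M B f" shows "f \<in> L2_space M"
proof -
  have [measurable]: "f \<in> borel_measurable M" and "AE x in M. norm (f x) \<le> B"
    using assms by (auto simp: ess_bounded_def)
  from this(2) have "AE x in M. norm ((norm (f x))\<^sup>2) \<le> B\<^sup>2"
    by eventually_elim (simp add: power_mono)
  then have "integrable M (\<lambda>x. (norm (f x))\<^sup>2)"
    by (rule integrable_const_bound) measurable
  then show ?thesis by (simp add: L2_space_def)
qed

lemma abs_inner_le_sum_squares:
  fixes a b :: "'b::real_inner"
  shows "\<bar>a \<bullet> b\<bar> \<le> (norm a)\<^sup>2 + (norm b)\<^sup>2"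
proof -
  have "\<bar>a \<bullet> b\<bar> \<le> norm a * norm b" by (rule Cauchy_Schwarz_ineq2)
  also have "\<dots> \<le> (norm a)\<^sup>2 + (norm b)\<^sup>2"
    using sum_squares_bound[of "norm a" "norm b"]
      mult_nonneg_nonneg[OF norm_ge_zero[of a] norm_ge_zero[of b]] by linarith
  finally show ?thesis .
qed

lemma integrable_inner_L2:
  assumes "f \<in> L2_space M" "h \<in> L2_space M"
  shows "integrable M (\<lambda>x. f x \<bullet> h x)"
proof (rule Bochner_Integration.integrable_bound)
  show "integrable M (\<lambda>x. (norm (f x))\<^sup>2 + (norm (h x))\<^sup>2)"
    using assms by (simp add: L2_space_def)
  have [measurable]: "f \<in> borel_measurable M" "h \<in> borel_measurable M"
    using assms by (auto simp: L2_space_def)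
  show "(\<lambda>x. f x \<bullet> h x) \<in> borel_measurable M" by measurable
qed (simp add: abs_inner_le_sum_squares)

lemma (in finite_measure) L2_inner_self_le:
  assumes "ess_bounded M B f"
  shows "L2_inner M f f \<le> B\<^sup>2 * measure M (space M)"
proof -
  have "(\<integral>x. f x \<bullet> f x \<partial>M) \<le> (\<integral>x. B\<^sup>2 \<partial>M)"
  proof (rule integral_mono_AE)
    have "AE x in M. norm (f x) \<le> B" using assms by (simp add: ess_bounded_def)
    then show "AE x in M. f x \<bullet> f x \<le> B\<^sup>2"
      by eventually_elim (simp add: power_mono flip: power2_norm_eq_inner)
  qed (auto intro: integrable_inner_L2 ess_bounded_imp_L2[OF assms])
  then show ?thesis by (simp add: L2_inner_def mult.commute)
qed

lemma abs_L2_inner_le: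
  assumes "f \<in> L2_space M" "h \<in> L2_space M"
  shows "\<bar>L2_inner M f h\<bar> \<le> L2_inner M f f + L2_inner M h h"
proof -
  note int = integrable_inner_L2[OF assms] integrable_inner_L2[OF assms(1,1)]
    integrable_inner_L2[OF assms(2,2)]
  have "\<bar>\<integral>x. f x \<bullet> h x \<partial>M\<bar> \<le> (\<integral>x. \<bar>f x \<bullet> h x\<bar> \<partial>M)"
    by (rule integral_abs_bound)
  also have "\<dots> \<le> (\<integral>x. f x \<bullet> f x + h x \<bullet> h x \<partial>M)"
  proof (rule integral_mono)
    show "\<bar>f x \<bullet> h x\<bar> \<le> f x \<bullet> f x + h x \<bullet> h x" for x
      using abs_inner_le_sum_squares[of "f x" "h x"] by (simp add: power2_norm_eq_inner)
  qed (use int in auto)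
  finally show ?thesis using int by (simp add: L2_inner_def)
qed

lemma L2_inner_commute: "L2_inner M f h = L2_inner M h f"
  by (simp add: L2_inner_def inner_commute)

lemma L2_space_midpoint:
  assumes "f \<in> L2_space M" "h \<in> L2_space M"
  shows "(\<lambda>x. (1/2) *\<^sub>R (f x + h x)) \<in> L2_space M"
proof -
  have [measurable]: "f \<in> borel_measurable M" "h \<in> borel_measurable M"
    using assms by (auto simp: L2_space_def)
  have "integrable M (\<lambda>x. (f x \<bullet> f x + 2 * (f x \<bullet> h x) + h x \<bullet> h x) / 4)"
    by (intro integrable_divide Bochner_Integration.integrable_add integrable_mult_right
        integrable_inner_L2 assms)
  then have "integrable M (\<lambda>x. (norm ((1/2) *\<^sub>R (f x + h x)))\<^sup>2)"
    by (rule Bochner_Integration.integrable_cong[THEN iffD1, rotated 2])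
      (auto simp: power2_norm_eq_inner inner_simps inner_commute field_simps)
  then show ?thesis by (simp add: L2_space_def)
qed

lemma L2_inner_midpoint:
  assumes "f \<in> L2_space M" "h \<in> L2_space M" "v \<in> L2_space M"
  shows "L2_inner M (\<lambda>x. (1/2) *\<^sub>R (f x + h x)) v = (L2_inner M f v + L2_inner M h v) / 2"
  using assms by (simp add: L2_inner_def inner_simps integrable_inner_L2 add_divide_distrib)

lemma midpoint_hull_L2:
  assumes "f \<in> midpoint_hull U" and "U \<subseteq> L2_space M"
  shows "f \<in> L2_space M"
  using assms by induction (auto intro: L2_space_midpoint)

text \<open>
  Inner products with a fixed \<open>v\<close> are affine along midpoints. With \<open>I\<close> a ball this transports
  convergence from a sequence to the hulls of its tails.
\<close>

lemma L2_inner_midpoint_hull_convex: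
  assumes "f \<in> midpoint_hull U" and "U \<subseteq> L2_space M" and "v \<in> L2_space M"
    and "convex I" and "\<And>h. h \<in> U \<Longrightarrow> L2_inner M h v \<in> I"
  shows "L2_inner M f v \<in> I"
  using assms(1)
proof induction
  case (midpoint f h)
  have "(1/2) *\<^sub>R L2_inner M f v + (1/2) *\<^sub>R L2_inner M h v \<in> I"
    using midpoint.IH by (intro convexD[OF \<open>convex I\<close>]) auto
  moreover have "f \<in> L2_space M" "h \<in> L2_space M"
    using midpoint.hyps assms(2) midpoint_hull_L2 by blast+
  ultimately show ?case by (simp add: L2_inner_midpoint assms add_divide_distrib)
qed (use assms in auto)

lemma L2_inner_tail_hull_tendsto:
  assumes "\<And>n. u n \<in> L2_space M" and "v \<in> L2_space M"
    and lim: "(\<lambda>n. L2_inner M (u n) v) \<longlonglongrightarrow> c"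
    and w: "\<And>k. w k \<in> midpoint_hull (u ` {k..})"
  shows "(\<lambda>k. L2_inner M (w k) v) \<longlonglongrightarrow> c"
proof (rule metric_LIMSEQ_I)
  fix e :: real assume "e > 0"
  with lim obtain N where N: "\<And>n. n \<ge> N \<Longrightarrow> L2_inner M (u n) v \<in> ball c e"
    by (auto simp: lim_sequentially dist_commute)
  have "L2_inner M (w k) v \<in> ball c e" if "k \<ge> N" for k
    by (rule L2_inner_midpoint_hull_convex[OF w]) (use assms N that in auto)
  then show "\<exists>N. \<forall>k\<ge>N. dist (L2_inner M (w k) v) c < e"
    by (auto simp: dist_commute)
qed

text \<open>
  Dominated convergence: the majorant \<open>B\<^sup>2 + (norm (v x))\<^sup>2\<close> is integrable because the measure is
  finite.
\<close>

lemma (in finite_measure) L2_inner_tendsto_of_AE: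
  assumes w: "\<And>k. ess_bounded M B (w k)" and l: "l \<in> borel_measurable M"
    and lim: "AE x in M. (\<lambda>k. w k x) \<longlonglongrightarrow> l x" and v: "v \<in> L2_space M"
  shows "(\<lambda>k. L2_inner M (w k) v) \<longlonglongrightarrow> L2_inner M l v"
  unfolding L2_inner_def
proof (rule integral_dominated_convergence)
  have [measurable]: "w k \<in> borel_measurable M" for k using w by (simp add: ess_bounded_def)
  have [measurable]: "v \<in> borel_measurable M" using v by (simp add: L2_space_def)
  note [measurable] = l
  show "(\<lambda>x. l x \<bullet> v x) \<in> borel_measurable M" "(\<lambda>x. w k x \<bullet> v x) \<in> borel_measurable M" for k
    by measurable
  show "integrable M (\<lambda>x. B\<^sup>2 + (norm (v x))\<^sup>2)"
    using v by (simp add: L2_space_def)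
  show "AE x in M. (\<lambda>k. w k x \<bullet> v x) \<longlonglongrightarrow> l x \<bullet> v x"
    using lim by eventually_elim (intro tendsto_intros)
  show "AE x in M. norm (w k x \<bullet> v x) \<le> B\<^sup>2 + (norm (v x))\<^sup>2" for k
  proof -
    have "AE x in M. norm (w k x) \<le> B" using w by (simp add: ess_bounded_def)
    then show ?thesis
    proof eventually_elim
      case (elim x)
      then have "(norm (w k x))\<^sup>2 \<le> B\<^sup>2" by (simp add: power_mono)
      then show ?case using abs_inner_le_sum_squares[of "w k x" "v x"] by simp
    qed
  qed
qed

lemma ess_bounded_lim:
  assumes w: "\<And>k. ess_bounded M B (w k)" and l: "l \<in> borel_measurable M"
    and lim: "AE x in M. (\<lambda>k. w k x) \<longlonglongrightarrow> l x"
  shows "ess_bounded M B l"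
proof -
  have "AE x in M. \<forall>k. norm (w k x) \<le> B"
    using w by (simp add: ess_bounded_def AE_all_countable)
  with lim have "AE x in M. norm (l x) \<le> B"
  proof eventually_elim
    case (elim x)
    then show ?case by (intro LIMSEQ_le_const2[OF tendsto_norm]) auto
  qed
  with l show ?thesis by (simp add: ess_bounded_def)
qed

text \<open>
  The two equations say that \<open>f - h\<close> is orthogonal to \<open>f\<close> and to \<open>h\<close>, hence to itself.
\<close>

lemma L2_eq_of_inner_eq:
  assumes "f \<in> L2_space M" "h \<in> L2_space M"
    and "L2_inner M f f = L2_inner M h f" "L2_inner M f h = L2_inner M h h"
  shows "AE x in M. f x = h x"
proof -
  note int = integrable_inner_L2[OF assms(1,1)] integrable_inner_L2[OF assms(1,2)]
    integrable_inner_L2[OF assms(2,1)] integrable_inner_L2[OF assms(2,2)]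
  have eq: "(f x - h x) \<bullet> (f x - h x) = (f x \<bullet> f x - h x \<bullet> f x) - (f x \<bullet> h x - h x \<bullet> h x)" for x
    by (simp add: inner_simps)
  have "integrable M (\<lambda>x. (f x - h x) \<bullet> (f x - h x))"
    unfolding eq using int by simp
  moreover have "(\<integral>x. (f x - h x) \<bullet> (f x - h x) \<partial>M) = 0"
    unfolding eq using int assms(3,4) by (simp add: L2_inner_def)
  ultimately have "AE x in M. (f x - h x) \<bullet> (f x - h x) = 0"
    by (subst (asm) integral_nonneg_eq_0_iff_AE) auto
  then show ?thesis by simp
qed

lemma L2_parallelogram:
  assumes "f \<in> L2_space M" "h \<in> L2_space M"
  shows "integrable M (\<lambda>x. (norm (f x - h x))\<^sup>2)"
    and "(\<integral>x. (norm (f x - h x))\<^sup>2 \<partial>M) = 2 * L2_inner M f f + 2 * L2_inner M h h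
      - 4 * L2_inner M (\<lambda>x. (1/2) *\<^sub>R (f x + h x)) (\<lambda>x. (1/2) *\<^sub>R (f x + h x))"
proof -
  let ?m = "\<lambda>x. (1/2) *\<^sub>R (f x + h x)"
  note int = integrable_inner_L2[OF assms(1,1)] integrable_inner_L2[OF assms(2,2)]
    integrable_inner_L2[OF L2_space_midpoint[OF assms] L2_space_midpoint[OF assms]]
  have eq: "(norm (f x - h x))\<^sup>2 = 2 * (f x \<bullet> f x) + 2 * (h x \<bullet> h x) - 4 * (?m x \<bullet> ?m x)" for x
    by (simp add: power2_norm_eq_inner inner_simps inner_commute field_simps)
  show "integrable M (\<lambda>x. (norm (f x - h x))\<^sup>2)"
    unfolding eq by (intro Bochner_Integration.integrable_diff Bochner_Integration.integrable_add integrable_mult_right int)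
  have "(\<integral>x. (norm (f x - h x))\<^sup>2 \<partial>M)
      = (\<integral>x. 2 * (f x \<bullet> f x) + 2 * (h x \<bullet> h x) \<partial>M) - (\<integral>x. 4 * (?m x \<bullet> ?m x) \<partial>M)"
    unfolding eq by (intro Bochner_Integration.integral_diff Bochner_Integration.integrable_add integrable_mult_right int)
  also have "(\<integral>x. 2 * (f x \<bullet> f x) + 2 * (h x \<bullet> h x) \<partial>M)
      = (\<integral>x. 2 * (f x \<bullet> f x) \<partial>M) + (\<integral>x. 2 * (h x \<bullet> h x) \<partial>M)"
    by (intro Bochner_Integration.integral_add integrable_mult_right int)
  finally show "(\<integral>x. (norm (f x - h x))\<^sup>2 \<partial>M) = 2 * L2_inner M f f + 2 * L2_inner M h h
      - 4 * L2_inner M ?m ?m"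
    unfolding L2_inner_def by simp
qed

section \<open>Almost everywhere limits from the hulls of tails\<close>

text \<open>
  The increments have summable \<open>L\<^sup>1\<close> norms, so by monotone convergence the series of their pointwise
  norms is finite almost everywhere, and the sequence telescopes.
\<close>

lemma (in finite_measure) AE_convergent_of_L2_fast_Cauchy:
  fixes w :: "nat \<Rightarrow> 'a \<Rightarrow> 'b::euclidean_space"
  assumes w: "\<And>i. w i \<in> L2_space M"
    and fast: "\<And>i. (\<integral>x. (norm (w (Suc i) x - w i x))\<^sup>2 \<partial>M) \<le> c * (1/4) ^ i"
  shows "\<exists>l \<in> borel_measurable M. AE x in M. (\<lambda>i. w i x) \<longlonglongrightarrow> l x"
proof -
  have [measurable]: "w i \<in> borel_measurable M" for i using w by (simp add: L2_space_def)
  define D where "D i x = norm (w (Suc i) x - w i x)" for i x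
  have [measurable]: "D i \<in> borel_measurable M" for i unfolding D_def by measurable
  have le: "(\<integral>\<^sup>+x. ennreal (D i x) \<partial>M) \<le> ennreal ((measure M (space M) + c) * (1/2) ^ i)" for i
  proof -
    let ?s = "(1/2 :: real) ^ i"
    have s2: "(1/4 :: real) ^ i = ?s * ?s"
      by (simp flip: power_mult_distrib)
    \<comment> \<open>Weighting with the square root of the rate \<open>(1/4) ^ i\<close> bounds the \<open>L\<^sup>1\<close> norm on a finite
      measure space by two terms that are both of order \<open>(1/2) ^ i\<close>.\<close>
    have pt: "D i x \<le> ?s + (D i x)\<^sup>2 / ?s" for x
    proof (cases "D i x \<le> ?s")
      case False
      then have "?s * D i x \<le> D i x * D i x" by (intro mult_right_mono) (auto simp: D_def)
      then have "D i x \<le> (D i x)\<^sup>2 / ?s"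
        by (simp add: pos_le_divide_eq power2_eq_square mult.commute)
      then show ?thesis by (simp add: add_increasing)
    qed (simp add: add_increasing2)
    have int: "integrable M (\<lambda>x. (D i x)\<^sup>2)"
      unfolding D_def by (rule L2_parallelogram w)+
    then have int': "integrable M (\<lambda>x. ?s + (D i x)\<^sup>2 / ?s)" by simp
    have "(\<integral>\<^sup>+x. ennreal (D i x) \<partial>M) \<le> (\<integral>\<^sup>+x. ennreal (?s + (D i x)\<^sup>2 / ?s) \<partial>M)"
      by (intro nn_integral_mono ennreal_leI pt)
    also have "\<dots> = ennreal (\<integral>x. ?s + (D i x)\<^sup>2 / ?s \<partial>M)"
      by (rule nn_integral_eq_integral[OF int']) simp
    also have "\<dots> \<le> ennreal ((measure M (space M) + c) * ?s)"
    proof (rule ennreal_leI)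
      have "(\<integral>x. ?s + (D i x)\<^sup>2 / ?s \<partial>M) = measure M (space M) * ?s + (\<integral>x. (D i x)\<^sup>2 \<partial>M) / ?s"
        using int by simp
      also have "(\<integral>x. (D i x)\<^sup>2 \<partial>M) / ?s \<le> c * (1/4) ^ i / ?s"
        using fast[of i] by (intro divide_right_mono) (auto simp: D_def)
      also have "c * (1/4) ^ i / ?s = c * ?s" by (simp add: s2)
      finally show "(\<integral>x. ?s + (D i x)\<^sup>2 / ?s \<partial>M) \<le> (measure M (space M) + c) * ?s"
        by (simp add: algebra_simps)
    qed
    finally show ?thesis .
  qed
  have "0 \<le> c"
  proof -
    have "0 \<le> (\<integral>x. (norm (w (Suc 0) x - w 0 x))\<^sup>2 \<partial>M)" by simp
    from order_trans[OF this fast[of 0]] show ?thesis by simp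
  qed
  have "(\<integral>\<^sup>+x. (\<Sum>i. ennreal (D i x)) \<partial>M) = (\<Sum>i. \<integral>\<^sup>+x. ennreal (D i x) \<partial>M)"
    by (rule nn_integral_suminf) measurable
  also have "\<dots> \<le> (\<Sum>i. ennreal ((measure M (space M) + c) * (1/2) ^ i))"
    by (intro suminf_le le) auto
  also have "\<dots> < top"
  proof -
    have "(\<Sum>i. ennreal ((measure M (space M) + c) * (1/2) ^ i)) \<noteq> top"
      using \<open>0 \<le> c\<close> by (intro ennreal_suminf_neq_top summable_mult summable_geometric) auto
    then show ?thesis by (simp add: top.not_eq_extremum)
  qed
  finally have "AE x in M. (\<Sum>i. ennreal (D i x)) \<noteq> \<infinity>"
    by (intro nn_integral_noteq_infinite) auto
  then have conv: "AE x in M. (\<lambda>i. w i x) \<longlonglongrightarrow> lim (\<lambda>i. w i x)"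
  proof eventually_elim
    case (elim x)
    then have "summable (\<lambda>i. norm (w (Suc i) x - w i x))"
      using summable_suminf_not_top[of "\<lambda>i. D i x"] by (simp add: D_def)
    then have "summable (\<lambda>i. w (Suc i) x - w i x)" by (rule summable_norm_cancel)
    then have "convergent (\<lambda>n. \<Sum>i<n. w (Suc i) x - w i x)"
      by (simp add: summable_iff_convergent)
    then have "convergent (\<lambda>n. w n x - w 0 x)"
      by (simp only: sum_lessThan_telescope[of "\<lambda>i. w i x"])
    then have "convergent (\<lambda>n. (w n x - w 0 x) + w 0 x)"
      by (intro convergent_add convergent_const)
    then show ?case by (simp add: convergent_LIMSEQ_iff)
  qed
  have "(\<lambda>x. lim (\<lambda>i. w i x)) \<in> borel_measurable M" by measurable
  with conv show ?thesis by (intro bexI[where x = "\<lambda>x. lim (\<lambda>i. w i x)"])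
qed

text \<open>
  Let \<open>d k\<close> be the infimum of the squared norm on the hull of the \<open>k\<close>-th tail. It increases to a
  finite limit \<open>D\<close>. If two elements of late hulls have squared norms close to \<open>D\<close>, their midpoint lies
  in the larger of the two hulls and has squared norm not much below \<open>D\<close> either, so by the
  parallelogram law the two elements are close to each other.
\<close>

lemma (in finite_measure) tail_hulls_AE_convergent:
  fixes u :: "nat \<Rightarrow> 'a \<Rightarrow> 'b::euclidean_space"
  assumes u: "\<And>n. ess_bounded M B (u n)"
  shows "\<exists>w l. (\<forall>k. w k \<in> midpoint_hull (u ` {k..})) \<and> (\<forall>k. ess_bounded M B (w k)) \<and>
    ess_bounded M B l \<and> (AE x in M. (\<lambda>k. w k x) \<longlonglongrightarrow> l x)"
proof -
  define C where "C k = midpoint_hull (u ` {k..})" for k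
  define d where "d k = Inf ((\<lambda>f. L2_inner M f f) ` C k)" for k
  have bdd: "ess_bounded M B f" if "f \<in> C k" for f k
    using that u unfolding C_def by (auto intro: ess_bounded_midpoint_hull)
  have nonneg: "0 \<le> L2_inner M f f" for f :: "'a \<Rightarrow> 'b" by (simp add: L2_inner_def)
  have bb: "bdd_below ((\<lambda>f. L2_inner M f f) ` A)" for A :: "('a \<Rightarrow> 'b) set"
    by (auto intro: bdd_belowI nonneg)
  have uC: "u k \<in> C k" for k by (auto simp: C_def intro: midpoint_hull.base)
  have d_le: "d k \<le> L2_inner M f f" if "f \<in> C k" for f k
    unfolding d_def using that by (intro cInf_lower bb imageI)
  have anti: "C l \<subseteq> C k" if "k \<le> l" for k l
    unfolding C_def using that by (intro midpoint_hull_mono) auto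
  have inc: "incseq d"
    unfolding incseq_def d_def using anti uC by (intro allI impI cInf_superset_mono bb) blast+
  have bound: "d k \<le> B\<^sup>2 * measure M (space M)" for k
    using d_le[OF uC, of k] L2_inner_self_le[OF u, of k] by linarith
  obtain D where D: "d \<longlonglongrightarrow> D" "\<And>k. d k \<le> D"
    using incseq_convergent[OF inc, of "B\<^sup>2 * measure M (space M)"] bound by blast
  have "\<exists>k f. i \<le> k \<and> D - (1/4)^i < d k \<and> f \<in> C k \<and> L2_inner M f f < D + (1/4)^i" for i
  proof -
    have "eventually (\<lambda>k. D - (1/4)^i < d k) sequentially"
      using D(1) by (intro order_tendstoD) auto
    then obtain k where k: "i \<le> k" "D - (1/4)^i < d k"
      by (metis eventually_sequentially nat_le_linear)
    have "d k < D + (1/4)^i" using D(2)[of k] zero_less_power[of "1/4 :: real" i] by linarith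
    then obtain f where "f \<in> C k" "L2_inner M f f < D + (1/4)^i"
      unfolding d_def using uC by (subst (asm) cInf_less_iff) (auto intro!: bb)
    with k show ?thesis by blast
  qed
  then obtain K w where K: "\<And>i. i \<le> K i" "\<And>i. D - (1/4)^i < d (K i)"
    and w: "\<And>i. w i \<in> C (K i)" "\<And>i. L2_inner M (w i) (w i) < D + (1/4)^i"
    by metis
  have wL2: "w i \<in> L2_space M" for i using w(1) bdd ess_bounded_imp_L2 by blast
  have "(\<integral>x. (norm (w (Suc i) x - w i x))\<^sup>2 \<partial>M) \<le> 8 * (1/4) ^ i" for i
  proof -
    \<comment> \<open>The indices \<open>K i\<close> need not increase, so the midpoint is located in the hull of the smaller one.\<close>
    define j where "j = min (K i) (K (Suc i))"
    have q: "(1/4 :: real) ^ Suc i \<le> (1/4) ^ i" by simp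
    have "w i \<in> C j" "w (Suc i) \<in> C j"
      using w(1)[of i] w(1)[of "Suc i"] anti[of j "K i"] anti[of j "K (Suc i)"]
      unfolding j_def by auto
    then have "(\<lambda>x. (1/2) *\<^sub>R (w (Suc i) x + w i x)) \<in> C j"
      unfolding C_def by (rule midpoint_hull.midpoint[rotated])
    from d_le[OF this] have m: "d j \<le> L2_inner M (\<lambda>x. (1/2) *\<^sub>R (w (Suc i) x + w i x)) (\<lambda>x. (1/2) *\<^sub>R (w (Suc i) x + w i x))" .
    have dj: "D - (1/4)^i < d j"
      using K(2)[of i] K(2)[of "Suc i"] q unfolding j_def min_def
      by (smt (verit))
    have "L2_inner M (w (Suc i)) (w (Suc i)) < D + (1/4)^i"
      using w(2)[of "Suc i"] q by linarith
    then show ?thesis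
      using L2_parallelogram(2)[OF wL2[of "Suc i"] wL2[of i]] m dj w(2)[of i] by linarith
  qed
  from AE_convergent_of_L2_fast_Cauchy[OF wL2 this]
  obtain l where l: "l \<in> borel_measurable M" "AE x in M. (\<lambda>i. w i x) \<longlonglongrightarrow> l x" by blast
  have wb: "ess_bounded M B (w k)" for k using w(1) bdd by blast
  have "w k \<in> midpoint_hull (u ` {k..})" for k
    using w(1)[of k] anti[OF K(1), of k] by (auto simp: C_def)
  with wb ess_bounded_lim[OF wb l] l(2) show ?thesis by blast
qed

section \<open>Weak sequential compactness\<close>

lemma real_tendsto_of_subseq_limits:
  fixes X :: "nat \<Rightarrow> real"
  assumes "bounded (range X)"
    and "\<And>s c. strict_mono s \<Longrightarrow> (\<lambda>n. X (s n)) \<longlonglongrightarrow> c \<Longrightarrow> c = L"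
  shows "X \<longlonglongrightarrow> L"
proof (rule ccontr)
  assume "\<not> X \<longlonglongrightarrow> L"
  then obtain e where "e > 0" and e: "\<And>N. \<exists>n\<ge>N. dist (X n) L \<ge> e"
    by (meson lim_sequentially not_less)
  have "infinite {n. dist (X n) L \<ge> e}"
    using e by (auto simp: infinite_nat_iff_unbounded_le)
  then obtain r :: "nat \<Rightarrow> nat" where r: "strict_mono r" "\<And>n. dist (X (r n)) L \<ge> e"
    using infinite_enumerate by blast
  have "bounded (range (X \<circ> r))"
    using assms(1) by (rule bounded_subset) auto
  then obtain c s where s: "strict_mono (s :: nat \<Rightarrow> nat)" "((X \<circ> r) \<circ> s) \<longlonglongrightarrow> c"
    using bounded_imp_convergent_subsequence by blast
  then have lim: "(\<lambda>n. X (r (s n))) \<longlonglongrightarrow> c" by (simp add: o_def)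
  moreover have "strict_mono (\<lambda>n. r (s n))"
    using strict_mono_o[OF r(1) s(1)] by (simp add: o_def)
  ultimately have "c = L" using assms(2)[of "\<lambda>n. r (s n)" c] by simp
  with lim \<open>e > 0\<close> obtain n where "dist (X (r (s n))) L < e"
    by (meson lim_sequentially order_refl)
  with r(2)[of "s n"] show False by simp
qed

text \<open>
  An almost everywhere limit taken from the hulls of the tails has the same inner product with \<open>h\<close> as
  the sequence has in the limit. This links the limits constructed above with weak convergence.
\<close>

lemma (in finite_measure) L2_inner_tail_hull_limit:
  assumes u: "\<And>n. u n \<in> L2_space M" and h: "h \<in> L2_space M"
    and c: "(\<lambda>n. L2_inner M (u n) h) \<longlonglongrightarrow> c"
    and w: "\<And>k. w k \<in> midpoint_hull (u ` {k..})" "\<And>k. ess_bounded M B (w k)"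
    and l: "ess_bounded M B l" "AE x in M. (\<lambda>k. w k x) \<longlonglongrightarrow> l x"
  shows "L2_inner M l h = c"
proof (rule LIMSEQ_unique)
  show "(\<lambda>k. L2_inner M (w k) h) \<longlonglongrightarrow> L2_inner M l h"
    using l(1) by (intro L2_inner_tendsto_of_AE[OF w(2) _ l(2) h]) (simp add: ess_bounded_def)
  show "(\<lambda>k. L2_inner M (w k) h) \<longlonglongrightarrow> c"
    by (rule L2_inner_tail_hull_tendsto[OF u h c w(1)])
qed

text \<open>
  After the diagonal extraction only the inner products with members of the sequence itself are
  known to converge. For an arbitrary test function \<open>h\<close>, let \<open>c\<close> be a limit of the inner products with
  \<open>h\<close> along some subsequence. The hull construction on that subsequence yields \<open>l'\<close> with inner
  product \<open>c\<close> with \<open>h\<close>. Now \<open>l - l'\<close> is orthogonal to every member, hence to the hulls and to their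
  limits \<open>l\<close> and \<open>l'\<close>; so \<open>l = l'\<close>, and \<open>c\<close> is determined by \<open>l\<close>.
\<close>

lemma (in finite_measure) ess_bounded_weakly_convergent_subseq:
  fixes u :: "nat \<Rightarrow> 'a \<Rightarrow> 'b::euclidean_space"
  assumes u: "\<And>n. ess_bounded M B (u n)"
  shows "\<exists>r l. strict_mono (r :: nat \<Rightarrow> nat) \<and> L2_weakly_tendsto M (\<lambda>n. u (r n)) l"
proof -
  have u2: "u n \<in> L2_space M" for n using ess_bounded_imp_L2[OF u] .
  define m where "m = B\<^sup>2 * measure M (space M)"
  have bd: "\<bar>L2_inner M (u n) h\<bar> \<le> m + L2_inner M h h" if "h \<in> L2_space M" for n h
    using abs_L2_inner_le[OF u2 that, of n] L2_inner_self_le[OF u, of n] unfolding m_def by linarith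
  have "norm (L2_inner M (u n) (u j)) \<le> m + m" for n j
    using bd[OF u2, of n j] L2_inner_self_le[OF u, of j] unfolding m_def real_norm_def by linarith
  then obtain r where r: "strict_mono (r :: nat \<Rightarrow> nat)"
    and conv: "\<And>j. j \<in> UNIV \<Longrightarrow> \<exists>a. (\<lambda>n. L2_inner M (u (r n)) (u j)) \<longlonglongrightarrow> a"
    by (rule function_convergent_subsequence[of "UNIV :: nat set" "\<lambda>n j. L2_inner M (u n) (u j)"
        "m + m", rotated]) auto
  define v where "v n = u (r n)" for n
  have v: "ess_bounded M B (v n)" and v2: "v n \<in> L2_space M" for n
    by (simp_all add: v_def u u2)
  define a where "a j = lim (\<lambda>n. L2_inner M (v n) (v j))" for j
  have a: "(\<lambda>n. L2_inner M (v n) (v j)) \<longlonglongrightarrow> a j" for j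
    using conv[of "r j"] unfolding a_def v_def convergent_LIMSEQ_iff[symmetric]
    by (simp add: convergent_def)
  obtain w l where w: "\<And>k. w k \<in> midpoint_hull (v ` {k..})" "\<And>k. ess_bounded M B (w k)"
    and l: "ess_bounded M B l" "AE x in M. (\<lambda>k. w k x) \<longlonglongrightarrow> l x"
    using tail_hulls_AE_convergent[of B v, OF v] by blast
  have la: "L2_inner M l (v j) = a j" for j
    by (rule L2_inner_tail_hull_limit[OF v2 v2 a w l])
  have wv: "w k \<in> midpoint_hull (range v)" for k
    using w(1)[of k] midpoint_hull_mono[of "v ` {k..}" "range v"] by auto
  have l2: "l \<in> L2_space M" using ess_bounded_imp_L2[OF l(1)] .
  have "(\<lambda>n. L2_inner M (v n) h) \<longlonglongrightarrow> L2_inner M l h" if h: "h \<in> L2_space M" for h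
  proof (rule real_tendsto_of_subseq_limits)
    show "bounded (range (\<lambda>n. L2_inner M (v n) h))"
      using bd[OF h] by (auto simp: bounded_iff v_def)
    fix s :: "nat \<Rightarrow> nat" and c
    assume s: "strict_mono s" and c: "(\<lambda>n. L2_inner M (v (s n)) h) \<longlonglongrightarrow> c"
    obtain w' l' where w': "\<And>k. w' k \<in> midpoint_hull ((\<lambda>n. v (s n)) ` {k..})"
        "\<And>k. ess_bounded M B (w' k)"
      and l': "ess_bounded M B l'" "AE x in M. (\<lambda>k. w' k x) \<longlonglongrightarrow> l' x"
      using tail_hulls_AE_convergent[of B "\<lambda>n. v (s n)", OF v] by blast
    note val = L2_inner_tail_hull_limit[OF v2 _ _ w' l']
    have l'a: "L2_inner M l' (v j) = a j" for j
      using LIMSEQ_subseq_LIMSEQ[OF a s] by (intro val v2) (simp add: o_def)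
    have w'v: "w' k \<in> midpoint_hull (range v)" for k
      using w'(1)[of k] midpoint_hull_mono[of "(\<lambda>n. v (s n)) ` {k..}" "range v"] by auto
    have l'2: "l' \<in> L2_space M" using ess_bounded_imp_L2[OF l'(1)] .
    have agree: "L2_inner M f l = L2_inner M f l'" if "f \<in> midpoint_hull (range v)" for f
      using that
    proof induction
      case (base f)
      then show ?case using la l'a by (auto simp: L2_inner_commute[of M _ l] L2_inner_commute[of M _ l'])
    next
      case (midpoint f h)
      moreover have "f \<in> L2_space M" "h \<in> L2_space M"
        using midpoint.hyps v2 midpoint_hull_L2 by blast+
      ultimately show ?case by (simp add: L2_inner_midpoint l2 l'2)
    qed
    have meas: "l \<in> borel_measurable M" "l' \<in> borel_measurable M" "h \<in> borel_measurable M"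
      using l2 l'2 h by (auto simp: L2_space_def)
    have "L2_inner M l l = L2_inner M l l'"
    proof (rule LIMSEQ_unique)
      show "(\<lambda>k. L2_inner M (w k) l) \<longlonglongrightarrow> L2_inner M l l"
        by (rule L2_inner_tendsto_of_AE[OF w(2) meas(1) l(2) l2])
      show "(\<lambda>k. L2_inner M (w k) l) \<longlonglongrightarrow> L2_inner M l l'"
        unfolding agree[OF wv] by (rule L2_inner_tendsto_of_AE[OF w(2) meas(1) l(2) l'2])
    qed
    moreover have "L2_inner M l' l = L2_inner M l' l'"
    proof (rule LIMSEQ_unique)
      show "(\<lambda>k. L2_inner M (w' k) l) \<longlonglongrightarrow> L2_inner M l' l"
        by (rule L2_inner_tendsto_of_AE[OF w'(2) meas(2) l'(2) l2])
      show "(\<lambda>k. L2_inner M (w' k) l) \<longlonglongrightarrow> L2_inner M l' l'"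
        unfolding agree[OF w'v] by (rule L2_inner_tendsto_of_AE[OF w'(2) meas(2) l'(2) l'2])
    qed
    ultimately have "AE x in M. l x = l' x"
      by (intro L2_eq_of_inner_eq l2 l'2) (simp_all add: L2_inner_commute[of M l' l])
    then have "AE x in M. l x \<bullet> h x = l' x \<bullet> h x" by eventually_elim simp
    then have "L2_inner M l h = L2_inner M l' h"
      unfolding L2_inner_def by (intro integral_cong_AE borel_measurable_inner meas)
    also have "\<dots> = c" by (rule val[OF h c])
    finally show "c = L2_inner M l h" by simp
  qed
  then have "L2_weakly_tendsto M (\<lambda>n. u (r n)) l"
    using v2 l2 by (simp add: L2_weakly_tendsto_def v_def)
  with r show ?thesis by blast
qed

section \<open>Weak lower semicontinuity of integral functionals\<close>

text \<open>
  A version of Mazur's lemma. The limit produced by the hull construction has the same inner products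
  as the weak limit, so the two agree almost everywhere.
\<close>

lemma (in finite_measure) weak_limit_AE_limit_of_tail_hulls:
  fixes u :: "nat \<Rightarrow> 'a \<Rightarrow> 'b::euclidean_space"
  assumes u: "\<And>n. ess_bounded M B (u n)" and weak: "L2_weakly_tendsto M u l"
  shows "\<exists>w. (\<forall>k. w k \<in> midpoint_hull (u ` {k..})) \<and> (AE x in M. (\<lambda>k. w k x) \<longlonglongrightarrow> l x)"
proof -
  obtain w l' where w: "\<And>k. w k \<in> midpoint_hull (u ` {k..})" "\<And>k. ess_bounded M B (w k)"
    and l': "ess_bounded M B l'" "AE x in M. (\<lambda>k. w k x) \<longlonglongrightarrow> l' x"
    using tail_hulls_AE_convergent[of B u, OF u] by blast
  have l2: "l \<in> L2_space M" and u2: "\<And>n. u n \<in> L2_space M"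
    and lim: "\<And>h. h \<in> L2_space M \<Longrightarrow> (\<lambda>n. L2_inner M (u n) h) \<longlonglongrightarrow> L2_inner M l h"
    using weak by (auto simp: L2_weakly_tendsto_def)
  have l'2: "l' \<in> L2_space M" using ess_bounded_imp_L2[OF l'(1)] .
  have "L2_inner M l' h = L2_inner M l h" if h: "h \<in> L2_space M" for h
    by (rule L2_inner_tail_hull_limit[OF u2 h lim[OF h] w l'])
  then have "AE x in M. l' x = l x"
    by (intro L2_eq_of_inner_eq l2 l'2) (simp_all add: l2 l'2)
  with l'(2) have "AE x in M. (\<lambda>k. w k x) \<longlonglongrightarrow> l x"
    by eventually_elim simp
  with w(1) show ?thesis by blast
qed

lemma borel_measurable_of_open_superlevel:
  fixes G :: "'b::topological_space \<Rightarrow> 'c::{linorder_topology, second_countable_topology}"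
  assumes "\<And>a. open {v. a < G v}"
  shows "G \<in> borel_measurable borel"
  using assms by (intro borel_measurableI_greater) auto

text \<open>
  The bound \<open>C\<close> passes to the midpoint hull by convexity and from there to the weak limit by Fatou's
  lemma, since the weak limit is an almost everywhere limit of elements of the hull. Openness of the
  strict superlevel sets expresses lower semicontinuity and at the same time gives measurability.
\<close>

lemma (in finite_measure) nn_integral_sublevel_weakly_closed:
  fixes G :: "'b::euclidean_space \<Rightarrow> ennreal" and u :: "nat \<Rightarrow> 'a \<Rightarrow> 'b"
  assumes lsc: "\<And>a. open {v. a < G v}"
    and mid: "\<And>v w. G ((1/2) *\<^sub>R (v + w)) \<le> (G v + G w) / 2"
    and u: "\<And>n. ess_bounded M B (u n)" and weak: "L2_weakly_tendsto M u l"
    and le: "\<And>n. (\<integral>\<^sup>+x. G (u n x) \<partial>M) \<le> C"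
  shows "(\<integral>\<^sup>+x. G (l x) \<partial>M) \<le> C"
proof -
  have G [measurable]: "G \<in> borel_measurable borel"
    by (rule borel_measurable_of_open_superlevel[OF lsc])
  obtain w where w: "\<And>k. w k \<in> midpoint_hull (u ` {k..})"
    and lim: "AE x in M. (\<lambda>k. w k x) \<longlonglongrightarrow> l x"
    using weak_limit_AE_limit_of_tail_hulls[OF u weak] by blast
  have bdd: "ess_bounded M B f" if "f \<in> midpoint_hull (range u)" for f
    using that u by (auto intro: ess_bounded_midpoint_hull)
  have w': "w k \<in> midpoint_hull (range u)" for k
    using w[of k] midpoint_hull_mono[of "u ` {k..}" "range u"] by auto
  have meas [measurable]: "f \<in> borel_measurable M" if "f \<in> midpoint_hull (range u)" for f
    using bdd[OF that] by (simp add: ess_bounded_def)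
  have hull: "(\<integral>\<^sup>+x. G (f x) \<partial>M) \<le> C" if "f \<in> midpoint_hull (range u)" for f
    using that
  proof induction
    case (midpoint f h)
    note [measurable] = meas[OF midpoint.hyps(1)] meas[OF midpoint.hyps(2)]
    have "(\<integral>\<^sup>+x. G ((1/2) *\<^sub>R (f x + h x)) \<partial>M) \<le> (\<integral>\<^sup>+x. (G (f x) + G (h x)) / 2 \<partial>M)"
      by (intro nn_integral_mono mid)
    also have "\<dots> = ((\<integral>\<^sup>+x. G (f x) \<partial>M) + (\<integral>\<^sup>+x. G (h x) \<partial>M)) / 2"
      by (simp add: nn_integral_divide nn_integral_add)
    also have "\<dots> \<le> (C + C) / 2"
      by (intro divide_right_mono_ennreal add_mono midpoint.IH)
    also have "(C + C) / 2 = C"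
      using ennreal_mult_divide_eq[of 2 C] by (simp add: mult_2_right)
    finally show ?case .
  qed (use le in auto)
  have "(\<integral>\<^sup>+x. G (l x) \<partial>M) \<le> (\<integral>\<^sup>+x. liminf (\<lambda>k. G (w k x)) \<partial>M)"
  proof (rule nn_integral_mono_AE)
    show "AE x in M. G (l x) \<le> liminf (\<lambda>k. G (w k x))"
      using lim
    proof eventually_elim
      case (elim x)
      show ?case
        unfolding le_Liminf_iff
      proof (intro allI impI)
        fix a assume "a < G (l x)"
        then show "\<forall>\<^sub>F k in sequentially. a < G (w k x)"
          using topological_tendstoD[OF elim lsc[of a]] by simp
      qed
    qed
  qed
  also have "\<dots> \<le> liminf (\<lambda>k. \<integral>\<^sup>+x. G (w k x) \<partial>M)"
    by (rule nn_integral_liminf) (use meas[OF w'] in measurable)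
  also have "\<dots> \<le> C"
    by (rule Liminf_le) (simp_all add: hull[OF w'])
  finally show ?thesis .
qed

section \<open>The energy as a sum of nonnegative terms\<close>

text \<open>
  The inferior limit in \<^const>\<open>lsc_fun\<close> is taken along the punctured neighbourhoods of \<open>v\<close>, so the
  value at \<open>v\<close> itself has to be added.
\<close>

lemma lsc_fun_open_superlevel:
  assumes "lsc_fun g" shows "open {v. a < g v}"
proof (subst open_subopen, intro ballI)
  fix v assume "v \<in> {v. a < g v}"
  then have v: "a < g v" by simp
  moreover have "g v \<le> Liminf (at v) g" using assms by (simp add: lsc_fun_def)
  ultimately have "eventually (\<lambda>y. a < g y) (at v)" using less_LiminfD less_le_trans by blast
  with v have "eventually (\<lambda>y. a < g y) (nhds v)" by (auto simp: eventually_nhds_conv_at)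
  then show "\<exists>T. open T \<and> v \<in> T \<and> T \<subseteq> {v. a < g v}" by (auto simp: eventually_nhds)
qed

text \<open>
  The open sets on which \<open>g\<close> exceeds \<open>- n\<close> cover \<open>K\<close>, so finitely many of them do; outside \<open>K\<close> the
  function is infinite.
\<close>

lemma lsc_fun_bounded_below:
  assumes lsc: "lsc_fun g" and "proper_fun g" and "compact K" and "edom g \<subseteq> K"
  obtains b where "0 \<le> b" "\<And>v. ereal (- b) \<le> g v"
proof -
  let ?U = "\<lambda>n::nat. {v. ereal (- real n) < g v}"
  have "K \<subseteq> (\<Union>n\<in>UNIV. ?U n)"
  proof
    fix v
    have "g v \<noteq> -\<infinity>" using assms by (simp add: proper_fun_def)
    then show "v \<in> (\<Union>n\<in>UNIV. ?U n)"
    proof (cases "g v")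
      case (real r)
      obtain n :: nat where "- r < real n" using reals_Archimedean2 by blast
      with real show ?thesis by (auto intro!: exI[of _ n])
    qed auto
  qed
  then obtain N where "finite N" and N: "K \<subseteq> (\<Union>n\<in>N. ?U n)"
    using lsc_fun_open_superlevel[OF lsc] by (auto intro: compactE_image[OF \<open>compact K\<close>, of UNIV ?U])
  define b where "b = (\<Sum>n\<in>N. real n)"
  have "ereal (- b) \<le> g v" for v
  proof (cases "v \<in> K")
    case True
    with N obtain n where n: "n \<in> N" "ereal (- real n) < g v" by blast
    then have "real n \<le> b"
      unfolding b_def using \<open>finite N\<close> by (intro member_le_sum) auto
    then have "ereal (- b) \<le> ereal (- real n)" by simp
    also have "\<dots> \<le> g v" using n(2) by simp
    finally show ?thesis .
  next
    case False
    with assms(4) have "g v = \<infinity>" by (auto simp: edom_def)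
    then show ?thesis by simp
  qed
  moreover have "0 \<le> b" by (simp add: b_def sum_nonneg)
  ultimately show ?thesis by (intro that)
qed

lemma e2ennreal_shift:
  assumes "0 \<le> b" "ereal (- b) \<le> y"
  shows "e2ennreal (y + ereal b) + e2ennreal (- y) = e2ennreal y + ennreal b"
proof (cases y)
  case (real r)
  show ?thesis
  proof (cases "0 \<le> r")
    case True
    then show ?thesis using real assms by (simp add: ennreal_neg flip: ennreal_plus)
  next
    case False
    then show ?thesis using real assms by (simp add: ennreal_neg flip: ennreal_plus)
  qed
qed (use assms in auto)

text \<open>
  Adding the lower bound turns the difference of the two parts into a single integral with values in
  the extended nonnegative reals, where monotone and Fatou arguments apply without subtraction. The
  negative part is at most \<open>b\<close>, so its integral is finite and can be cancelled.
\<close>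

lemma (in finite_measure) ereal_integral_eq_shifted:
  assumes f [measurable]: "f \<in> borel_measurable M"
    and b: "0 \<le> b" "\<And>x. ereal (- b) \<le> f x"
  shows "ereal_integral M f =
    enn2ereal (\<integral>\<^sup>+x. e2ennreal (f x + ereal b) \<partial>M) - ereal (b * measure M (space M))"
proof -
  define p q s where "p = (\<integral>\<^sup>+x. e2ennreal (f x) \<partial>M)" and "q = (\<integral>\<^sup>+x. e2ennreal (- f x) \<partial>M)"
    and "s = (\<integral>\<^sup>+x. e2ennreal (f x + ereal b) \<partial>M)"
  let ?c = "b * measure M (space M)"
  have c: "(\<integral>\<^sup>+x. ennreal b \<partial>M) = ennreal ?c"
    using b(1) by (simp add: emeasure_eq_measure ennreal_mult)
  have "s + q = (\<integral>\<^sup>+x. e2ennreal (f x + ereal b) + e2ennreal (- f x) \<partial>M)"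
    unfolding s_def q_def by (rule nn_integral_add[symmetric]) measurable
  also have "\<dots> = (\<integral>\<^sup>+x. e2ennreal (f x) + ennreal b \<partial>M)"
    by (simp add: e2ennreal_shift b)
  also have "\<dots> = p + ennreal ?c"
    unfolding p_def c[symmetric] by (rule nn_integral_add) measurable
  finally have eq: "s + q = p + ennreal ?c" .
  have "q \<le> (\<integral>\<^sup>+x. ennreal b \<partial>M)"
    unfolding q_def
  proof (rule nn_integral_mono)
    fix x
    have "- f x \<le> ereal b" using b(2)[of x] by (simp add: ereal_uminus_le_reorder)
    then show "e2ennreal (- f x) \<le> ennreal b" using e2ennreal_mono by fastforce
  qed
  then have "q < top" unfolding c using ennreal_less_top le_less_trans by blast
  then obtain q' where q: "q = ennreal q'" "0 \<le> q'" by (auto simp: less_top_ennreal)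
  have c0: "0 \<le> ?c" using b(1) by simp
  have "enn2ereal p - enn2ereal q = enn2ereal s - ereal ?c"
  proof (cases p)
    case (real p')
    with eq c0 have "s \<noteq> top" by (auto simp flip: ennreal_plus)
    then obtain s' where s: "s = ennreal s'" "0 \<le> s'" by (cases s) auto
    with eq q real c0 have "s' + q' = p' + ?c" by (simp flip: ennreal_plus)
    then show ?thesis using real q s by (simp add: enn2ereal_ennreal)
  next
    case top
    with eq q have "s = top" by (cases s) (auto simp flip: ennreal_plus)
    with top q show ?thesis by (simp add: enn2ereal_ennreal)
  qed
  then show ?thesis by (simp add: ereal_integral_def p_def q_def s_def)
qed

text \<open>
  For every competitor the energy and the nonnegative expression compared here differ by the same
  finite constant \<open>b * measure M (space M)\<close>.
\<close>

lemma (in finite_measure) is_minimizer_iff_shifted: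
  assumes lsc: "lsc_fun g" and b: "0 \<le> b" "\<And>v. ereal (- b) \<le> g v"
  shows "is_minimizer M S g z u \<longleftrightarrow> u \<in> L2_space M \<and> (\<forall>v\<in>L2_space M.
    ennreal (1/2 * (norm (S u - z))\<^sup>2) + (\<integral>\<^sup>+x. e2ennreal (g (u x) + ereal b) \<partial>M) \<le>
    ennreal (1/2 * (norm (S v - z))\<^sup>2) + (\<integral>\<^sup>+x. e2ennreal (g (v x) + ereal b) \<partial>M))"
    (is "_ \<longleftrightarrow> _ \<and> (\<forall>v\<in>_. ?E u \<le> ?E v)")
proof -
  have [measurable]: "g \<in> borel_measurable borel"
    by (rule borel_measurable_of_open_superlevel[OF lsc_fun_open_superlevel[OF lsc]])
  have eq: "energy M S g z v = enn2ereal (?E v) - ereal (b * measure M (space M))"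
    if v: "v \<in> L2_space M" for v
  proof -
    have [measurable]: "v \<in> borel_measurable M" using v by (simp add: L2_space_def)
    show ?thesis
      unfolding energy_def
      by (subst ereal_integral_eq_shifted[of "\<lambda>x. g (v x)" b])
        (use b in \<open>auto simp: plus_ennreal.rep_eq enn2ereal_ennreal minus_ereal_def add.assoc\<close>)
  qed
  have "energy M S g z v < energy M S g z u \<longleftrightarrow> \<not> ?E u \<le> ?E v"
    if "v \<in> L2_space M" "u \<in> L2_space M" for v
    unfolding eq[OF that(1)] eq[OF that(2)] not_le less_ennreal.rep_eq
    by (cases "enn2ereal (?E u)"; cases "enn2ereal (?E v)") auto
  then show ?thesis
    unfolding is_minimizer_def is_arg_min_def by blast
qed

lemma e2ennreal_shift_midpoint_convex:
  assumes conv: "convex_fun g" and b: "\<And>v. ereal (- b) \<le> g v"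
  shows "e2ennreal (g ((1/2) *\<^sub>R (v + w)) + ereal b)
    \<le> (e2ennreal (g v + ereal b) + e2ennreal (g w + ereal b)) / 2"
proof -
  have "g ((1 - 1/2) *\<^sub>R v + (1/2) *\<^sub>R w) \<le> ereal (1 - 1/2) * g v + ereal (1/2) * g w"
    using conv unfolding convex_fun_def by (elim allE[of _ v] allE[of _ w] ballE[of _ _ "1/2"]) auto
  then have le: "g ((1/2) *\<^sub>R (v + w)) \<le> ereal (1/2) * g v + ereal (1/2) * g w"
    by (simp add: scaleR_add_right)
  show ?thesis
  proof (cases "g v = \<infinity> \<or> g w = \<infinity>")
    case True
    then have "(e2ennreal (g v + ereal b) + e2ennreal (g w + ereal b)) / 2 = top"
      by (auto simp: ennreal_top_divide)
    then show ?thesis by simp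
  next
    case False
    then obtain r s where rs: "g v = ereal r" "g w = ereal s" "- b \<le> r" "- b \<le> s"
      using b[of v] b[of w] by (cases "g v"; cases "g w") auto
    have "g ((1/2) *\<^sub>R (v + w)) + ereal b \<le> ereal ((r + b + (s + b)) / 2)"
      using le rs by (cases "g ((1/2) *\<^sub>R (v + w))") (auto simp: field_simps)
    then have "e2ennreal (g ((1/2) *\<^sub>R (v + w)) + ereal b) \<le> ennreal ((r + b + (s + b)) / 2)"
      using e2ennreal_mono by fastforce
    also have "\<dots> = (e2ennreal (g v + ereal b) + e2ennreal (g w + ereal b)) / 2"
    proof -
      have "ennreal ((r + b + (s + b)) / 2) = ennreal (r + b + (s + b)) / ennreal 2"
        using rs by (intro divide_ennreal[symmetric]) auto
      also have "ennreal (r + b + (s + b)) = ennreal (r + b) + ennreal (s + b)"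
        using rs by (intro ennreal_plus) auto
      finally show ?thesis using rs by simp
    qed
    finally show ?thesis .
  qed
qed

lemma open_superlevel_e2ennreal_shift:
  assumes "lsc_fun g"
  shows "open {v. a < e2ennreal (g v + ereal b)}"
proof -
  have "a < e2ennreal (y + ereal b) \<longleftrightarrow> enn2ereal a - ereal b < y" for y
  proof -
    have "a < e2ennreal (y + ereal b) \<longleftrightarrow> enn2ereal a < y + ereal b"
    proof (cases "0 \<le> y + ereal b")
      case True
      then show ?thesis by (simp add: less_ennreal.rep_eq enn2ereal_e2ennreal)
    next
      case False
      then have "\<not> enn2ereal a < y + ereal b"
        using enn2ereal_nonneg[of a] by (meson le_less_trans less_imp_le not_le)
      with False show ?thesis by (simp add: e2ennreal_neg)
    qed
    also have "\<dots> \<longleftrightarrow> enn2ereal a - ereal b < y"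
      by (cases "enn2ereal a"; cases y) auto
    finally show ?thesis .
  qed
  then show ?thesis using lsc_fun_open_superlevel[OF assms] by simp
qed

text \<open>
  A constant function with value in the domain of \<open>g\<close> is a competitor of finite energy.
\<close>

lemma (in finite_measure) minimizer_AE_in_edom:
  fixes g :: "'b::euclidean_space \<Rightarrow> ereal"
  assumes lsc: "lsc_fun g" and "proper_fun g" and b: "0 \<le> b" "\<And>v. ereal (- b) \<le> g v"
    and min: "is_minimizer M S g z u"
  shows "AE x in M. u x \<in> edom g"
proof -
  have [measurable]: "g \<in> borel_measurable borel"
    by (rule borel_measurable_of_open_superlevel[OF lsc_fun_open_superlevel[OF lsc]])
  have [measurable]: "u \<in> borel_measurable M"
    using min by (simp add: is_minimizer_iff_shifted[OF lsc b] L2_space_def)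
  obtain c where c: "g c < \<infinity>" using \<open>proper_fun g\<close> by (auto simp: proper_fun_def edom_def)
  have "(\<lambda>_. c) \<in> L2_space M" by (rule ess_bounded_imp_L2[of "norm c"]) (simp add: ess_bounded_def)
  then have "ennreal (1/2 * (norm (S u - z))\<^sup>2) + (\<integral>\<^sup>+x. e2ennreal (g (u x) + ereal b) \<partial>M)
      \<le> ennreal (1/2 * (norm (S (\<lambda>_. c) - z))\<^sup>2) + (\<integral>\<^sup>+x. e2ennreal (g c + ereal b) \<partial>M)"
    using min unfolding is_minimizer_iff_shifted[OF lsc b] by blast
  also have "\<dots> < top"
  proof -
    have "e2ennreal (g c + ereal b) < top" using c by (cases "g c") (auto simp: e2ennreal_neg)
    then show ?thesis by (auto simp: ennreal_mult_less_top emeasure_eq_measure)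
  qed
  finally have "(\<integral>\<^sup>+x. e2ennreal (g (u x) + ereal b) \<partial>M) \<noteq> \<infinity>" by auto
  then have "AE x in M. e2ennreal (g (u x) + ereal b) \<noteq> \<infinity>"
    by (intro nn_integral_noteq_infinite) auto
  then show ?thesis
    by eventually_elim (auto simp: edom_def)
qed

section \<open>Limits of minimizers\<close>

lemma weakly_tendsto_unique_limit:
  assumes "weakly_tendsto y l" and "y \<longlonglongrightarrow> l'" shows "l' = l"
proof -
  have "(\<lambda>i. y i \<bullet> (l' - l)) \<longlonglongrightarrow> l' \<bullet> (l' - l)" by (intro tendsto_intros assms)
  moreover have "(\<lambda>i. y i \<bullet> (l' - l)) \<longlonglongrightarrow> l \<bullet> (l' - l)"
    using assms(1) by (simp add: weakly_tendsto_def)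
  ultimately have "l' \<bullet> (l' - l) = l \<bullet> (l' - l)" by (rule LIMSEQ_unique)
  then have "(l' - l) \<bullet> (l' - l) = 0" by (simp add: inner_diff_left)
  then show ?thesis by simp
qed

lemma L2_weakly_tendsto_subseq:
  assumes "L2_weakly_tendsto M u l" "strict_mono s"
  shows "L2_weakly_tendsto M (\<lambda>k. u (s k)) l"
  using assms LIMSEQ_subseq_LIMSEQ[OF _ assms(2)]
  by (fastforce simp: L2_weakly_tendsto_def o_def)

lemma (in finite_measure) ess_bounded_imp_L2_bounded:
  assumes "\<And>n. ess_bounded M B (u n)"
  shows "L2_bounded M (range u)"
proof -
  have "L2_norm M (u n) \<le> sqrt (B\<^sup>2 * measure M (space M))" for n
    using L2_inner_self_le[OF assms, of n] by (simp add: L2_norm_def L2_inner_def power2_norm_eq_inner)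
  moreover have "u n \<in> L2_space M" for n using ess_bounded_imp_L2[OF assms] .
  ultimately show ?thesis by (auto simp: L2_bounded_def)
qed

text \<open>
  Compactness provides some strong limit of the states along a subsequence; weak-to-weak continuity
  identifies it.
\<close>

lemma (in finite_measure) compact_operator_strong_subseq:
  fixes S :: "('a \<Rightarrow> 'b::euclidean_space) \<Rightarrow> 'y::real_inner"
  assumes u: "\<And>n. ess_bounded M B (u n)" and weak: "L2_weakly_tendsto M u l"
    and ww: "weak_to_weak_continuous M S" and comp: "compact_operator M S"
  shows "\<exists>s. strict_mono (s :: nat \<Rightarrow> nat) \<and> (\<lambda>k. S (u (s k))) \<longlonglongrightarrow> S l"
proof -
  have "compact (closure (S ` range u))"
    using comp ess_bounded_imp_L2_bounded[of B u, OF u] by (simp add: compact_operator_def)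
  then have "seq_compact (closure (S ` range u))" by (rule compact_imp_seq_compact)
  then have "\<forall>f. (\<forall>n. f n \<in> closure (S ` range u)) \<longrightarrow>
      (\<exists>y\<in>closure (S ` range u). \<exists>s :: nat \<Rightarrow> nat. strict_mono s \<and> (f \<circ> s) \<longlonglongrightarrow> y)"
    by (simp add: seq_compact_def)
  from spec[OF this, of "\<lambda>n. S (u n)"] obtain y s
    where "strict_mono (s :: nat \<Rightarrow> nat)" "((\<lambda>n. S (u n)) \<circ> s) \<longlonglongrightarrow> y"
    using closure_subset[of "S ` range u"] by blast
  then have s: "strict_mono s" "(\<lambda>k. S (u (s k))) \<longlonglongrightarrow> y" by (simp_all add: o_def)
  have "weakly_tendsto (\<lambda>k. S (u (s k))) (S l)"
    using ww L2_weakly_tendsto_subseq[OF weak s(1)] by (simp add: weak_to_weak_continuous_def)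
  from weakly_tendsto_unique_limit[OF this s(2)] s show ?thesis by blast
qed

text \<open>
  Fix a competitor \<open>v\<close> with finite \<open>\<phi> v\<close>. Minimality of \<open>u n\<close> bounds \<open>\<phi> (u n)\<close> by real numbers \<open>\<gamma> n\<close>
  that converge, because the states and the data converge strongly. For every \<open>e > 0\<close> a tail of the
  sequence therefore lies in one sublevel set of \<open>\<phi>\<close>, which is weakly closed.
\<close>

lemma (in finite_measure) weak_limit_of_minimizers:
  fixes S :: "('a \<Rightarrow> 'b::euclidean_space) \<Rightarrow> 'y::real_inner" and g :: "'b \<Rightarrow> ereal"
  assumes lsc: "lsc_fun g" and conv: "convex_fun g" and b: "0 \<le> b" "\<And>v. ereal (- b) \<le> g v"
    and u: "\<And>n. ess_bounded M B (u n)" and weak: "L2_weakly_tendsto M u l"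
    and S: "(\<lambda>n. S (u n)) \<longlonglongrightarrow> S l" and z: "z \<longlonglongrightarrow> z'"
    and min: "\<And>n. is_minimizer M S g (z n) (u n)"
  shows "is_minimizer M S g z' l"
proof -
  define \<phi> where "\<phi> v = (\<integral>\<^sup>+x. e2ennreal (g (v x) + ereal b) \<partial>M)" for v
  define t where "t z v = 1/2 * (norm (S v - z))\<^sup>2" for z v
  note iff = is_minimizer_iff_shifted[OF lsc b, of S, folded t_def \<phi>_def]
  have t0: "0 \<le> t z v" for z v by (simp add: t_def)
  have "ennreal (t z' l) + \<phi> l \<le> ennreal (t z' v) + \<phi> v" if v: "v \<in> L2_space M" for v
  proof (cases "\<phi> v")
    case (real f)
    define \<gamma> where "\<gamma> n = t (z n) v + f - t (z n) (u n)" for n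
    have le: "ennreal (t (z n) (u n)) + \<phi> (u n) \<le> ennreal (t (z n) v + f)" for n
    proof -
      have "ennreal (t (z n) (u n)) + \<phi> (u n) \<le> ennreal (t (z n) v) + \<phi> v"
        using min[of n] v by (simp add: iff)
      with real t0 show ?thesis by simp
    qed
    have lim: "\<gamma> \<longlonglongrightarrow> t z' v + f - t z' l"
      unfolding \<gamma>_def t_def by (intro tendsto_intros S z)
    have \<phi>_le: "\<phi> (u n) \<le> ennreal (\<gamma> n)" and \<gamma>0: "0 \<le> \<gamma> n" for n
    proof -
      have "\<phi> (u n) \<noteq> top" using le[of n] by (auto simp: top_unique)
      then obtain p where p: "\<phi> (u n) = ennreal p" "0 \<le> p" by (cases "\<phi> (u n)") auto
      with le[of n] t0 real have "t (z n) (u n) + p \<le> t (z n) v + f"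
        by (simp flip: ennreal_plus)
      with p show "\<phi> (u n) \<le> ennreal (\<gamma> n)" "0 \<le> \<gamma> n" by (auto simp: \<gamma>_def intro!: ennreal_leI)
    qed
    have lim0: "0 \<le> t z' v + f - t z' l"
      using lim \<gamma>0 by (intro LIMSEQ_le_const) auto
    have "\<phi> l \<le> ennreal (t z' v + f - t z' l)"
    proof (rule ennreal_le_epsilon)
      fix e :: real assume "0 < e"
      then have "eventually (\<lambda>n. \<gamma> n < t z' v + f - t z' l + e) sequentially"
        using lim by (intro order_tendstoD) auto
      then obtain N where N: "\<And>n. n \<ge> N \<Longrightarrow> \<gamma> n < t z' v + f - t z' l + e"
        by (auto simp: eventually_sequentially)
      have "\<phi> l \<le> ennreal (t z' v + f - t z' l + e)"
        unfolding \<phi>_def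
      proof (rule nn_integral_sublevel_weakly_closed[OF _ _ u])
        show "L2_weakly_tendsto M (\<lambda>n. u (n + N)) l"
          by (rule L2_weakly_tendsto_subseq[OF weak]) (simp add: strict_mono_def)
        show "(\<integral>\<^sup>+x. e2ennreal (g (u (n + N) x) + ereal b) \<partial>M) \<le> ennreal (t z' v + f - t z' l + e)" for n
          using order_trans[OF \<phi>_le ennreal_leI, of "n + N"] N[of "n + N"] by (simp add: \<phi>_def)
      qed (use open_superlevel_e2ennreal_shift[OF lsc] e2ennreal_shift_midpoint_convex[OF conv b(2)] in auto)
      then show "\<phi> l \<le> ennreal (t z' v + f - t z' l) + ennreal e"
        using lim0 \<open>0 < e\<close> by (simp flip: ennreal_plus)
    qed
    then have "ennreal (t z' l) + \<phi> l \<le> ennreal (t z' l) + ennreal (t z' v + f - t z' l)"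
      by (rule add_left_mono)
    also have "\<dots> = ennreal (t z' v) + \<phi> v"
      using real t0 lim0 by (simp flip: ennreal_plus)
    finally show ?thesis .
  qed simp
  moreover have "l \<in> L2_space M" using weak by (simp add: L2_weakly_tendsto_def)
  ultimately show ?thesis by (simp add: iff)
qed

theorem corollary3p2:
  fixes \<Omega> :: "(real ^ 'n) set"
    and S :: "(real ^ 'n \<Rightarrow> real ^ 'm) \<Rightarrow> 'y::{real_inner, complete_space}"
    and \<M> :: "(real ^ 'm) set"
    and g :: "real ^ 'm \<Rightarrow> ereal"
    and z :: "nat \<Rightarrow> 'y" and z' :: 'y
    and u :: "nat \<Rightarrow> real ^ 'n \<Rightarrow> real ^ 'm"
  assumes "open \<Omega>" and "bounded \<Omega>" and "\<Omega> \<noteq> {}"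
    and "CARD('m) \<ge> 2"
    and "finite \<M>"
    and "proper_fun g" and "convex_fun g" and "lsc_fun g"
    and "edom g = convex hull \<M>"
    and "L2_operator (lebesgue_on \<Omega>) S"
    and "weak_to_weak_continuous (lebesgue_on \<Omega>) S"
    and "compact_operator (lebesgue_on \<Omega>) S"
    and "z \<longlonglongrightarrow> z'"
    and "\<And>n. is_minimizer (lebesgue_on \<Omega>) S g (z n) (u n)"
  shows "\<exists>r u'. strict_mono (r :: nat \<Rightarrow> nat) \<and>
    is_minimizer (lebesgue_on \<Omega>) S g z' u' \<and>
    L2_weakly_tendsto (lebesgue_on \<Omega>) (\<lambda>k. u (r k)) u' \<and>
    (\<lambda>k. S (u (r k))) \<longlonglongrightarrow> S u'"
proof -
  interpret finite_measure "lebesgue_on \<Omega>"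
    using assms(1,2) by (intro finite_measure_lebesgue_on lmeasurable_open)
  have K: "compact (edom g)"
    unfolding assms(9) using \<open>finite \<M>\<close> by (rule finite_imp_compact_convex_hull)
  obtain b where b: "0 \<le> b" "\<And>v. ereal (- b) \<le> g v"
    using lsc_fun_bounded_below[OF \<open>lsc_fun g\<close> \<open>proper_fun g\<close> K] by blast
  obtain B where B: "\<And>v. v \<in> edom g \<Longrightarrow> norm v \<le> B"
    using compact_imp_bounded[OF K] by (auto simp: bounded_iff)
  have u: "ess_bounded (lebesgue_on \<Omega>) B (u n)" for n
  proof -
    have "AE x in lebesgue_on \<Omega>. norm (u n x) \<le> B"
      using minimizer_AE_in_edom[OF assms(8,6) b assms(14)[of n]] by eventually_elim (rule B)
    moreover have "u n \<in> borel_measurable (lebesgue_on \<Omega>)"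
      using assms(14)[of n] by (simp add: is_minimizer_def is_arg_min_def L2_space_def)
    ultimately show ?thesis by (simp add: ess_bounded_def)
  qed
  obtain r l where r: "strict_mono r" and l: "L2_weakly_tendsto (lebesgue_on \<Omega>) (\<lambda>n. u (r n)) l"
    using ess_bounded_weakly_convergent_subseq[of B u, OF u] by blast
  obtain s where s: "strict_mono s" "(\<lambda>k. S (u (r (s k)))) \<longlonglongrightarrow> S l"
    using compact_operator_strong_subseq[of B "\<lambda>n. u (r n)", OF u l assms(11,12)] by blast
  have rs: "strict_mono (\<lambda>k. r (s k))" using strict_mono_o[OF r s(1)] by (simp add: o_def)
  have weak: "L2_weakly_tendsto (lebesgue_on \<Omega>) (\<lambda>k. u (r (s k))) l"
    by (rule L2_weakly_tendsto_subseq[OF l s(1)])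
  have "(\<lambda>k. z (r (s k))) \<longlonglongrightarrow> z'"
    using LIMSEQ_subseq_LIMSEQ[OF assms(13) rs] by (simp add: o_def)
  then have "is_minimizer (lebesgue_on \<Omega>) S g z' l"
    by (rule weak_limit_of_minimizers[OF assms(8,7) b u weak s(2) _ assms(14)])
  with rs weak s(2) show ?thesis by blast
qed

end
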